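(* Let $k\ge 0$ be an integer. Let $\mathcal{A}_k(x)$ be the exponential generating function (in the number $n$ of vertices) for the total number of balanced vertices of rank $k$ in all non-plane 1-2 trees on $[n]$, and let $\mathcal{R}_k(x)$ be the exponential generating function for the number of non-plane 1-2 trees on $[n]$ in which the root is balanced and of rank $k$. Let $y(x)=\tan x+\sec x$. Then the differential equation $$\mathcal{A}_k'(x)-\mathcal{A}_k(x)\,y(x)=\mathcal{R}_k'(x)$$ holds, with the initial condition $\mathcal{A}_k(0)=0$.
   Context: A non-plane 1-2 tree on vertex set $[n]=\{1,\dots,n\}$ is a rooted tree whose vertices are bijectively labeled by $[n]$, in which every vertex has a smaller label than its parent, and every non-leaf vertex has one or two children; the children of a vertex are unordered (left and right do not matter). The number of such trees is the Euler number $E_n$, with $\sum_{n\ge 0}E_n\frac{x^n}{n!}=\tan x+\sec x$ (so $E_0=1$). A leaf is a vertex with no children. A vertex $v$ of a rooted tree is called balanced if all descending paths from $v$ to a leaf have the same length (number of edges); that common length is the rank of $v$. In particular leaves are balanced, of rank $0$. The exponential generating function of a sequence $(s_n)$ is $\sum_{n\ge0}s_n\frac{x^n}{n!}$; for $n=0$ there are no vertices and no root, so the constant terms of $\mathcal{A}_k$ and $\mathcal{R}_k$ are $0$. *)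

theory Defs
  imports "HOL-Computational_Algebra.Formal_Power_Series"
begin

(* A rooted tree on the vertex set V with root r is given by its parent-child relation T:
   (u, v) \<in> T means that u is the parent of v.  Siblings are unordered. *)

definition rooted_tree :: "'a set \<Rightarrow> 'a \<Rightarrow> ('a \<times> 'a) set \<Rightarrow> bool" where
  "rooted_tree V r T \<longleftrightarrow>
     r \<in> V \<and> T \<subseteq> V \<times> V \<and>
     (\<nexists>u. (u, r) \<in> T) \<and>
     (\<forall>v\<in>V - {r}. \<exists>!u. (u, v) \<in> T) \<and>
     (\<forall>v\<in>V. (r, v) \<in> T\<^sup>*)"

definition children :: "('a \<times> 'a) set \<Rightarrow> 'a \<Rightarrow> 'a set" where
  "children T v = {c. (v, c) \<in> T}"

definition leaf :: "('a \<times> 'a) set \<Rightarrow> 'a \<Rightarrow> bool" where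
  "leaf T v \<longleftrightarrow> children T v = {}"

(* The trees on [n], as pairs of root and parent-child relation.  A rooted tree has a root, so
   there is none for n = 0. *)

definition trees12 :: "nat \<Rightarrow> (nat \<times> (nat \<times> nat) set) set" where
  "trees12 n = {(r, T). rooted_tree {1..n} r T \<and>
     (\<forall>u v. (u, v) \<in> T \<longrightarrow> v < u) \<and>
     (\<forall>v\<in>{1..n}. \<not> leaf T v \<longrightarrow> card (children T v) \<in> {1, 2})}"

(* (v, w) \<in> T ^^ l holds iff there is a descending path with l edges from v to w. *)

definition leaf_path_lengths :: "('a \<times> 'a) set \<Rightarrow> 'a \<Rightarrow> nat set" where
  "leaf_path_lengths T v = {l. \<exists>w. leaf T w \<and> (v, w) \<in> T ^^ l}"

definition balanced :: "('a \<times> 'a) set \<Rightarrow> 'a \<Rightarrow> bool" where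
  "balanced T v \<longleftrightarrow>
     (\<forall>l\<in>leaf_path_lengths T v. \<forall>m\<in>leaf_path_lengths T v. l = m)"

(* Only meaningful for balanced vertices. *)

definition balanced_rank :: "('a \<times> 'a) set \<Rightarrow> 'a \<Rightarrow> nat" where
  "balanced_rank T v = (THE l. l \<in> leaf_path_lengths T v)"

definition num_balanced :: "nat \<Rightarrow> nat \<Rightarrow> nat" where
  "num_balanced k n =
     (\<Sum>(r, T)\<in>trees12 n. card {v \<in> {1..n}. balanced T v \<and> balanced_rank T v = k})"

definition num_root_balanced :: "nat \<Rightarrow> nat \<Rightarrow> nat" where
  "num_root_balanced k n =
     card {(r, T). (r, T) \<in> trees12 n \<and> balanced T r \<and> balanced_rank T r = k}"

definition egf :: "(nat \<Rightarrow> nat) \<Rightarrow> real fps" where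
  "egf s = Abs_fps (\<lambda>n. of_nat (s n) / fact n)"

definition A_egf :: "nat \<Rightarrow> real fps" where
  "A_egf k = egf (num_balanced k)"

definition R_egf :: "nat \<Rightarrow> real fps" where
  "R_egf k = egf (num_root_balanced k)"

definition y_fps :: "real fps" where
  "y_fps = fps_tan 1 + 1 / fps_cos 1"

end

theory Submission
  imports Defs "HOL-Library.Infinite_Set"
begin

text \<open>
  Delete the root \<open>m\<close> of a tree on \<open>V\<close>.  What remains are at most two trees on complementary
  label sets.  Fix in addition a vertex \<open>v \<noteq> m\<close>: this orders the two pieces, the
  piece \<open>B\<close> that contains \<open>v\<close> coming first, and the second piece may be empty.  So a tree with a
  distinguished vertex below the root is the same thing as a subset \<open>B\<close> of \<open>V - {m}\<close>, a tree on \<open>B\<close>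
  with a distinguished vertex, and a tree, possibly empty, on the remaining labels.  The
  distinguished vertex removes the symmetry factor \<open>2\<close> of unordered pairs of subtrees.

  Whether \<open>v\<close> is balanced, and of which rank, depends on the lengths of the paths from \<open>v\<close> to leaves
  alone, and these do not change when \<open>v\<close> is viewed inside its piece.  Hence, for every property \<open>Q\<close>
  of such sets of lengths, the generating function \<open>A\<close> of trees with a distinguished vertex that has
  \<open>Q\<close>, and the generating function \<open>R\<close> of trees whose root has \<open>Q\<close>, satisfy \<open>A' = R' + A Y\<close>, where
  \<open>Y\<close> counts trees including the empty one (lemma \<open>marked_egf_equation\<close>).

  It remains to see that \<open>Y = tan x + sec x\<close>, and the same equation gives this as well.  If \<open>Q\<close> is
  always true, then \<open>A = x Y'\<close> and \<open>R = Y - 1\<close>, and the equation becomes \<open>Y'' = Y' Y\<close>, with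
  \<open>Y(0) = Y'(0) = 1\<close>.  The series \<open>tan x + sec x\<close> solves the same initial value problem, because
  it satisfies \<open>2 y' = 1 + y\<^sup>2\<close>, and a power series solution is unique (lemma \<open>tree_egf_eq_y\<close>).
\<close>

section \<open>Decreasing trees on a finite set of labels\<close>

text \<open>
  The trees of \<open>trees12\<close>, on any finite label set.  The root must carry the largest label, so it is
  not recorded, and reachability from the root follows from the other conditions.  On the empty label
  set there is exactly one relation, which is the empty tree; \<open>Max {}\<close> is then never consulted.
\<close>
definition dec_trees :: "nat set \<Rightarrow> (nat \<times> nat) set set" where
  "dec_trees V = {T. T \<subseteq> V \<times> V \<and> (\<forall>u v. (u, v) \<in> T \<longrightarrow> v < u) \<and>
     (\<forall>v\<in>V. v \<noteq> Max V \<longrightarrow> (\<exists>!u. (u, v) \<in> T)) \<and> (\<forall>v\<in>V. card (children T v) \<le> 2)}"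

lemma dec_treesD:
  assumes "T \<in> dec_trees V"
  shows "(u, v) \<in> T \<Longrightarrow> u \<in> V" "(u, v) \<in> T \<Longrightarrow> v \<in> V" "(u, v) \<in> T \<Longrightarrow> v < u"
    "v \<in> V \<Longrightarrow> v \<noteq> Max V \<Longrightarrow> \<exists>u. (u, v) \<in> T"
    "v \<in> V \<Longrightarrow> card (children T v) \<le> 2"
  using assms unfolding dec_trees_def by blast+

lemma finite_dec_trees: "finite V \<Longrightarrow> finite (dec_trees V)"
  by (rule finite_subset[of _ "Pow (V \<times> V)"]) (auto simp: dec_trees_def)

lemma dec_trees_empty [simp]: "dec_trees {} = {{}}"
  by (auto simp: dec_trees_def)

lemma dec_trees_no_parent_Max:
  assumes "T \<in> dec_trees V" "finite V"
  shows "(u, Max V) \<notin> T"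
  using dec_treesD[OF assms(1)] Max_ge[OF assms(2)] by (meson leD)

lemma dec_trees_parent_unique:
  assumes "T \<in> dec_trees V" "finite V" "(u, v) \<in> T" "(u', v) \<in> T"
  shows "u = u'"
proof -
  have "v \<in> V" "v \<noteq> Max V"
    using assms dec_treesD(2) dec_trees_no_parent_Max by blast+
  then show ?thesis
    using assms unfolding dec_trees_def by blast
qed

text \<open>Parents have larger labels, so climbing from any vertex ends at the largest label.\<close>
lemma dec_trees_reachable:
  assumes "T \<in> dec_trees V" "finite V" "v \<in> V"
  shows "(Max V, v) \<in> T\<^sup>*"
  using assms(3)
proof (induction "Max V - v" arbitrary: v rule: less_induct)
  case less
  show ?case
  proof (cases "v = Max V")
    case False
    then obtain u where u: "(u, v) \<in> T"
      using dec_treesD(4) assms(1) less.prems by blast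
    then have "u \<in> V" "v < u"
      using dec_treesD assms(1) by blast+
    moreover from this have "u \<le> Max V"
      using assms(2) by simp
    ultimately have "(Max V, u) \<in> T\<^sup>*"
      using less.hyps[of u] by simp
    then show ?thesis
      using u by (rule rtrancl_into_rtrancl)
  qed simp
qed

lemma trees12_eq:
  assumes "n > 0"
  shows "trees12 n = Pair n ` dec_trees {1..n}"
proof -
  have mx: "Max {1..n} = n"
    using assms by (simp add: Max_eq_iff)
  have card_iff: "(\<not> leaf T v \<longrightarrow> card (children T v) \<in> {1, 2}) \<longleftrightarrow> card (children T v) \<le> 2"
    if "T \<subseteq> {1..n} \<times> {1..n}" for T v
  proof -
    have "finite (children T v)"
      by (rule finite_subset[of _ "{1..n}"]) (use that in \<open>auto simp: children_def\<close>)
    then show ?thesis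
      by (auto simp: leaf_def le_Suc_eq numeral_2_eq_2)
  qed
  have "(r, T) \<in> trees12 n \<longleftrightarrow> r = n \<and> T \<in> dec_trees {1..n}" for r T
  proof
    assume t: "(r, T) \<in> trees12 n"
    then have rt: "rooted_tree {1..n} r T" and dec: "\<And>u v. (u, v) \<in> T \<Longrightarrow> v < u"
      and ch: "\<And>v. v \<in> {1..n} \<Longrightarrow> card (children T v) \<le> 2"
      using card_iff by (auto simp: trees12_def rooted_tree_def)
    have "y \<le> x" if "(x, y) \<in> T\<^sup>*" for x y
      using that by induction (auto dest: dec)
    moreover have "(r, n) \<in> T\<^sup>*" "r \<in> {1..n}"
      using rt assms by (auto simp: rooted_tree_def)
    ultimately have "r = n"
      by fastforce
    then show "r = n \<and> T \<in> dec_trees {1..n}"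
      using rt dec ch mx unfolding rooted_tree_def dec_trees_def by auto
  next
    assume *: "r = n \<and> T \<in> dec_trees {1..n}"
    then have sub: "T \<subseteq> {1..n} \<times> {1..n}"
      by (simp add: dec_trees_def)
    have "\<exists>!u. (u, v) \<in> T" if "v \<in> {1..n} - {n}" for v
      using * that mx unfolding dec_trees_def by auto
    moreover have "\<nexists>u. (u, n) \<in> T" "\<forall>v\<in>{1..n}. (n, v) \<in> T\<^sup>*"
      using * dec_trees_no_parent_Max[of T "{1..n}"] dec_trees_reachable[of T "{1..n}"] mx by auto
    ultimately have "rooted_tree {1..n} n T"
      using sub assms unfolding rooted_tree_def by auto
    then show "(r, T) \<in> trees12 n"
      using * card_iff[OF sub] unfolding trees12_def dec_trees_def by auto
  qed
  then show ?thesis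
    by auto
qed

lemma trees12_0: "trees12 0 = {}"
  by (auto simp: trees12_def rooted_tree_def)


section \<open>Path lengths are local and invariant under relabelling\<close>

text \<open>
  A descending path that starts in a set closed under taking children never leaves it, so relations
  that agree on the set cannot be told apart by its path lengths.
\<close>
lemma leaf_path_lengths_cong:
  assumes "\<And>x y. x \<in> B \<Longrightarrow> (x, y) \<in> T \<longleftrightarrow> (x, y) \<in> S"
    and "\<And>x y. x \<in> B \<Longrightarrow> (x, y) \<in> S \<Longrightarrow> y \<in> B" and "v \<in> B"
  shows "leaf_path_lengths T v = leaf_path_lengths S v"
proof -
  have *: "((v, w) \<in> T ^^ l \<longleftrightarrow> (v, w) \<in> S ^^ l) \<and> ((v, w) \<in> S ^^ l \<longrightarrow> w \<in> B)" for l w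
  proof (induction l arbitrary: w)
    case (Suc l)
    then show ?case
      using assms(1,2) by (simp add: relcomp_unfold) blast
  qed (use assms(3) in auto)
  moreover have "leaf T w \<longleftrightarrow> leaf S w" if "w \<in> B" for w
    using assms(1) that by (auto simp: leaf_def children_def)
  ultimately show ?thesis
    unfolding leaf_path_lengths_def by blast
qed

lemma leaf_path_lengths_relabel:
  assumes "inj f"
  shows "leaf_path_lengths (map_prod f f ` T) (f v) = leaf_path_lengths T v"
proof -
  define U where "U = map_prod f f ` T"
  have edge: "(f x, y) \<in> U \<longleftrightarrow> (\<exists>y'. y = f y' \<and> (x, y') \<in> T)" for x y
    using assms unfolding U_def by (auto simp: inj_eq)
  have path: "(f v, w) \<in> U ^^ l \<longleftrightarrow> (\<exists>w'. w = f w' \<and> (v, w') \<in> T ^^ l)" for l w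
  proof (induction l arbitrary: w)
    case (Suc l)
    have "(f v, w) \<in> U ^^ Suc l \<longleftrightarrow> (\<exists>u. (f v, u) \<in> U ^^ l \<and> (u, w) \<in> U)"
      by (simp only: relpow.simps relcomp_unfold mem_Collect_eq case_prod_conv)
    also have "\<dots> \<longleftrightarrow> (\<exists>u. (v, u) \<in> T ^^ l \<and> (f u, w) \<in> U)"
      unfolding Suc by blast
    also have "\<dots> \<longleftrightarrow> (\<exists>w'. w = f w' \<and> (v, w') \<in> T ^^ Suc l)"
      unfolding edge by auto
    finally show ?case .
  qed auto
  have "leaf U (f w) \<longleftrightarrow> leaf T w" for w
    using edge by (auto simp: leaf_def children_def)
  then show ?thesis
    unfolding leaf_path_lengths_def path U_def[symmetric] by auto
qed

lemma dec_trees_relabel: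
  assumes "T \<in> dec_trees V" "finite V" "inj f" "strict_mono_on V f"
  shows "map_prod f f ` T \<in> dec_trees (f ` V)"
proof -
  let ?T = "map_prod f f ` T"
  have sub: "T \<subseteq> V \<times> V" and un: "\<And>v. v \<in> V \<Longrightarrow> v \<noteq> Max V \<Longrightarrow> \<exists>!u. (u, v) \<in> T"
    and ch: "\<And>v. v \<in> V \<Longrightarrow> card (children T v) \<le> 2" and dec: "\<And>u v. (u, v) \<in> T \<Longrightarrow> v < u"
    using assms(1) by (auto simp: dec_trees_def)
  have edge: "(u, f v) \<in> ?T \<longleftrightarrow> (\<exists>u'. u = f u' \<and> (u', v) \<in> T)" for u v
    using assms(3) by (auto simp: inj_eq)
  have "children ?T (f v) = f ` children T v" for v
    using assms(3) by (auto simp: children_def inj_eq)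
  then have "card (children ?T (f v)) \<le> 2" if "v \<in> V" for v
    using ch[OF that] card_image[of f "children T v"] inj_on_subset[OF assms(3)] by simp
  moreover have "y < x" if "(x, y) \<in> ?T" for x y
    using that sub dec strict_mono_onD[OF assms(4)] by fastforce
  moreover have "\<exists>!u. (u, f v) \<in> ?T" if v: "v \<in> V" and ne: "f v \<noteq> Max (f ` V)" for v
  proof -
    have "f (Max V) = Max (f ` V)"
      using v assms(2)
      by (intro Max_eqI[symmetric])
        (auto intro!: strict_mono_on_leD[OF assms(4)] Max_ge Max_in)
    then have "v \<noteq> Max V"
      using ne by auto
    from un[OF v this] show ?thesis
      unfolding edge by blast
  qed
  ultimately show ?thesis
    using sub unfolding dec_trees_def by auto
qed

text \<open>
  The property \<open>Q\<close> is applied to the path lengths only, so that it survives relabelling and deletion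
  of the root.
\<close>
definition marked_trees :: "(nat set \<Rightarrow> bool) \<Rightarrow> nat set \<Rightarrow> ((nat \<times> nat) set \<times> nat) set" where
  "marked_trees Q V = (SIGMA T:dec_trees V. {v \<in> V. Q (leaf_path_lengths T v)})"

lemma finite_marked_trees: "finite V \<Longrightarrow> finite (marked_trees Q V)"
  by (auto simp: marked_trees_def finite_dec_trees)

text \<open>
  The bijection is made injective on all of \<open>nat\<close>, because leaves and paths are defined without
  reference to a vertex set.
\<close>
lemma order_isomorphism_extends_to_inj:
  fixes V V' :: "nat set"
  assumes "finite V" "finite V'" "card V = card V'"
  obtains f where "inj f" "strict_mono_on V f" "f ` V = V'"
proof -
  obtain g where g: "bij_betw g {..<card V} V" "strict_mono_on {..<card V} g"
    using ex_bij_betw_strict_mono_card[OF assms(1)] .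
  obtain h where h: "bij_betw h {..<card V} V'" "strict_mono_on {..<card V} h"
    using ex_bij_betw_strict_mono_card[OF assms(2)] assms(3) by metis
  define e where "e = inv_into {..<card V} g"
  have e: "bij_betw e V {..<card V}"
    unfolding e_def using g(1) by (rule bij_betw_inv_into)
  have ge: "g (e x) = x" if "x \<in> V" for x
    unfolding e_def using g(1) that by (simp add: bij_betw_inv_into_right)
  have e_mono: "e x < e y" if "x \<in> V" "y \<in> V" "x < y" for x y
  proof (rule ccontr)
    assume "\<not> e x < e y"
    then have "g (e y) \<le> g (e x)"
      using strict_mono_on_leD[OF g(2), of "e y" "e x"] bij_betwE[OF e] that by auto
    then show False
      using ge that by simp
  qed
  have he: "bij_betw (h \<circ> e) V V'"
    using e h(1) by (rule bij_betw_trans)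
  \<comment> \<open>Labels outside \<open>V\<close> are shifted beyond \<open>V'\<close>.\<close>
  define f where "f x = (if x \<in> V then h (e x) else x + Suc (Max V'))" for x
  have in_V': "f x \<in> V'" if "x \<in> V" for x
    using bij_betwE[OF he] that by (simp add: f_def)
  have small: "f x \<le> Max V'" if "x \<in> V" for x
    using in_V'[OF that] assms(2) by simp
  have "inj f"
  proof (rule injI)
    fix x y assume xy: "f x = f y"
    have "x \<in> V \<longleftrightarrow> y \<in> V"
      using small[of x] small[of y] xy by (auto simp: f_def split: if_splits)
    then show "x = y"
      using xy bij_betw_imp_inj_on[OF he] by (auto simp: f_def inj_on_def split: if_splits)
  qed
  moreover have "strict_mono_on V f"
    using e_mono h(2) bij_betwE[OF e] by (auto simp: strict_mono_on_def f_def)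
  moreover have "f ` V = V'"
    using bij_betw_imp_surj_on[OF he] by (auto simp: f_def)
  ultimately show ?thesis
    using that by blast
qed

lemma inj_relabel: "inj f \<Longrightarrow> inj ((`) (map_prod f f))"
  by (intro injI) (simp add: inj_image_eq_iff prod.inj_map)

text \<open>
  Relabelling along an order isomorphism is injective; used in both directions, this yields equality
  of the cardinalities without computing an inverse.
\<close>
lemma card_dec_trees_cong:
  assumes "finite V" "finite V'" "card V = card V'"
  shows "card (dec_trees V) = card (dec_trees V')"
proof -
  have "card (dec_trees V) \<le> card (dec_trees V')"
    if fin: "finite V" "finite V'" and c: "card V = card V'" for V V'
  proof -
    obtain f where f: "inj f" "strict_mono_on V f" "f ` V = V'"
      using order_isomorphism_extends_to_inj[OF fin c] .
    have "inj ((`) (map_prod f f))"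
      by (rule inj_relabel[OF f(1)])
    then show ?thesis
      using dec_trees_relabel[OF _ fin(1) f(1,2)] f(3)
      by (intro card_inj_on_le[of "(`) (map_prod f f)"] finite_dec_trees fin) 
        (auto intro: inj_on_subset)
  qed
  then show ?thesis
    using assms by (metis le_antisym)
qed

lemma card_marked_trees_cong:
  assumes "finite V" "finite V'" "card V = card V'"
  shows "card (marked_trees Q V) = card (marked_trees Q V')"
proof -
  have "card (marked_trees Q V) \<le> card (marked_trees Q V')"
    if fin: "finite V" "finite V'" and c: "card V = card V'" for V V'
  proof -
    obtain f where f: "inj f" "strict_mono_on V f" "f ` V = V'"
      using order_isomorphism_extends_to_inj[OF fin c] .
    let ?F = "map_prod ((`) (map_prod f f)) f"
    have "inj ?F"
      by (intro prod.inj_map inj_relabel f(1))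
    moreover have "?F ` marked_trees Q V \<subseteq> marked_trees Q V'"
      using dec_trees_relabel[OF _ fin(1) f(1,2)] f leaf_path_lengths_relabel[OF f(1)]
      by (auto simp: marked_trees_def)
    ultimately show ?thesis
      by (intro card_inj_on_le[of ?F] finite_marked_trees fin) (auto intro: inj_on_subset)
  qed
  then show ?thesis
    using assms by (metis le_antisym)
qed


section \<open>Removing the root\<close>

text \<open>The root of a tree on \<open>B\<close>, as a set in order to cover the empty tree.\<close>
definition root_set :: "nat set \<Rightarrow> nat set" where
  "root_set B = (if B = {} then {} else {Max B})"

definition join :: "nat \<Rightarrow> nat set \<Rightarrow> nat set \<Rightarrow> (nat \<times> nat) set \<Rightarrow> (nat \<times> nat) set \<Rightarrow> (nat \<times> nat) set"
  where "join m B C T S = T \<union> S \<union> {m} \<times> (root_set B \<union> root_set C)"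

lemma root_set_iff: "finite B \<Longrightarrow> b \<in> root_set B \<longleftrightarrow> b \<in> B \<and> b = Max B"
  unfolding root_set_def using Max_in by (metis empty_iff singleton_iff)

context
  fixes m :: nat and B C :: "nat set" and T S :: "(nat \<times> nat) set"
  assumes fin: "finite B" "finite C" and disj: "B \<inter> C = {}"
    and below: "\<And>x. x \<in> B \<union> C \<Longrightarrow> x < m"
    and T: "T \<in> dec_trees B" and S: "S \<in> dec_trees C"
begin

lemma join_edge_iff:
  "x \<in> B \<Longrightarrow> (x, y) \<in> join m B C T S \<longleftrightarrow> (x, y) \<in> T"
  "x \<in> C \<Longrightarrow> (x, y) \<in> join m B C T S \<longleftrightarrow> (x, y) \<in> S"
  "(m, y) \<in> join m B C T S \<longleftrightarrow> y \<in> root_set B \<union> root_set C"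
  using disj below dec_treesD(1)[OF T] dec_treesD(1)[OF S] by (fastforce simp: join_def)+

lemma join_sub: "join m B C T S \<subseteq> insert m (B \<union> C) \<times> (B \<union> C)"
  using fin dec_treesD(1,2)[OF T] dec_treesD(1,2)[OF S] by (auto simp: join_def root_set_iff)

lemma Max_join: "Max (insert m (B \<union> C)) = m"
  using fin below by (intro Max_eqI) (auto intro: less_imp_le)

lemma join_parent:
  assumes v: "v \<in> B \<union> C"
  shows "\<exists>!u. (u, v) \<in> join m B C T S"
proof -
  have gen: "\<exists>!u. (u, v) \<in> T' \<union> S' \<union> {m} \<times> (root_set B' \<union> root_set C')"
    if "v \<in> B'" "finite B'" "finite C'" "B' \<inter> C' = {}" "T' \<in> dec_trees B'" "S' \<in> dec_trees C'"
    for B' C' T' S'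
  proof -
    have *: "(u, v) \<in> T' \<union> S' \<union> {m} \<times> (root_set B' \<union> root_set C') \<longleftrightarrow>
        (if v = Max B' then u = m else (u, v) \<in> T')" for u
      using that dec_treesD(2)[OF that(6)] dec_trees_no_parent_Max[OF that(5,2)]
      by (auto simp: root_set_iff)
    show ?thesis
      unfolding * using that dec_treesD(4) dec_trees_parent_unique by (metis (full_types))
  qed
  show ?thesis
  proof (cases "v \<in> B")
    case True
    then show ?thesis
      using gen[of B C T S] fin disj T S by (simp add: join_def)
  next
    case False
    then have "\<exists>!u. (u, v) \<in> S \<union> T \<union> {m} \<times> (root_set C \<union> root_set B)"
      using gen[of C B S T] fin disj T S v by blast
    then show ?thesis
      by (simp add: join_def Un_commute)
  qed
qed

lemma join_dec_trees: "join m B C T S \<in> dec_trees (insert m (B \<union> C))"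
proof -
  have "children (join m B C T S) x = children T x" if "x \<in> B" for x
    using join_edge_iff(1)[OF that] by (auto simp: children_def)
  moreover have "children (join m B C T S) x = children S x" if "x \<in> C" for x
    using join_edge_iff(2)[OF that] by (auto simp: children_def)
  moreover have "card (children (join m B C T S) m) \<le> 2"
  proof -
    have "children (join m B C T S) m = root_set B \<union> root_set C"
      using join_edge_iff(3) by (auto simp: children_def)
    moreover have "card (root_set B) \<le> 1" "card (root_set C) \<le> 1"
      by (auto simp: root_set_def)
    ultimately show ?thesis
      using card_Un_le[of "root_set B" "root_set C"] by simp
  qed
  ultimately have "\<forall>v\<in>insert m (B \<union> C). card (children (join m B C T S) v) \<le> 2"
    using dec_treesD(5)[OF T] dec_treesD(5)[OF S] by auto
  moreover have "v < u" if "(u, v) \<in> join m B C T S" for u v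
    using that below fin dec_treesD(3)[OF T] dec_treesD(3)[OF S] by (auto simp: join_def root_set_iff)
  moreover have "\<exists>!u. (u, v) \<in> join m B C T S"
    if "v \<in> insert m (B \<union> C)" "v \<noteq> Max (insert m (B \<union> C))" for v
    using join_parent that unfolding Max_join by blast
  ultimately show ?thesis
    using join_sub unfolding dec_trees_def by blast
qed

lemma join_leaf_path_lengths:
  "v \<in> B \<Longrightarrow> leaf_path_lengths (join m B C T S) v = leaf_path_lengths T v"
  using join_edge_iff(1) dec_treesD(2)[OF T] by (rule leaf_path_lengths_cong[of B])

lemma join_restrict: "join m B C T S \<inter> B \<times> B = T" "join m B C T S \<inter> C \<times> C = S"
  using join_edge_iff(1,2) dec_treesD(1,2)[OF T] dec_treesD(1,2)[OF S] by auto

text \<open>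
  The joined tree and \<open>v\<close> determine \<open>B\<close>, as the connected component of \<open>v\<close> after deletion of \<open>m\<close>:
  no edge runs between \<open>B\<close> and \<open>C\<close>, and \<open>B\<close> is connected since \<open>Max B\<close> reaches all of it.
  This is what makes the decomposition at a distinguished vertex injective.
\<close>
lemma join_component:
  assumes v: "v \<in> B"
  defines "E \<equiv> {(x, y) \<in> join m B C T S. x \<noteq> m}"
  shows "B = {x. (v, x) \<in> (E \<union> E\<inverse>)\<^sup>*}"
proof -
  have E: "E = T \<union> S"
    using below[of m] dec_treesD(1)[OF T] dec_treesD(1)[OF S] by (auto simp: E_def join_def)
  have "x \<in> B" if "(v, x) \<in> (E \<union> E\<inverse>)\<^sup>*" for x
    using that
  proof induction
    case (step y z)
    then show ?case
      using dec_treesD(1,2)[OF T] dec_treesD(1,2)[OF S] disj unfolding E by blast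
  qed (rule v)
  moreover have "(v, x) \<in> (E \<union> E\<inverse>)\<^sup>*" if "x \<in> B" for x
  proof -
    have "(v, Max B) \<in> (T\<inverse>)\<^sup>*" "(Max B, x) \<in> T\<^sup>*"
      using dec_trees_reachable[OF T fin(1)] v that by (auto simp: rtrancl_converse)
    moreover have "(T\<inverse>)\<^sup>* \<subseteq> (E \<union> E\<inverse>)\<^sup>*" "T\<^sup>* \<subseteq> (E \<union> E\<inverse>)\<^sup>*"
      unfolding E by (intro rtrancl_mono; auto)+
    ultimately show ?thesis
      by (meson rtrancl_trans subsetD)
  qed
  ultimately show ?thesis
    by blast
qed

end

text \<open>
  The decomposition is also surjective: \<open>B\<close> consists of the descendants of the child \<open>c\<close> of the
  root that lies above \<open>v\<close>.  That the rest is again a single tree, or empty, is where the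
  bound on the number of children enters.
\<close>
lemma dec_trees_split:
  assumes T: "T \<in> dec_trees (insert m W)" and fin: "finite W"
    and below: "\<And>x. x \<in> W \<Longrightarrow> x < m" and v: "v \<in> W"
  obtains B where "B \<subseteq> W" "v \<in> B" "T \<inter> B \<times> B \<in> dec_trees B"
    "T \<inter> (W - B) \<times> (W - B) \<in> dec_trees (W - B)"
    "T = join m B (W - B) (T \<inter> B \<times> B) (T \<inter> (W - B) \<times> (W - B))"
proof -
  let ?V = "insert m W"
  have finV: "finite ?V"
    using fin by simp
  have mx: "Max ?V = m"
    using fin below by (intro Max_eqI) (auto intro: less_imp_le)
  have edge: "u \<in> ?V" "x \<in> W" "x < u" if "(u, x) \<in> T" for u x
    using dec_treesD(1-3)[OF T that] dec_trees_no_parent_Max[OF T finV] mx that by auto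
  note uniq = dec_trees_parent_unique[OF T finV]
  have parent: "\<exists>u. (u, x) \<in> T" if "x \<in> W" for x
    using dec_treesD(4)[OF T, of x] mx below[OF that] that by auto
  have "(m, v) \<in> T\<^sup>*"
    using dec_trees_reachable[OF T finV, of v] mx v by simp
  then obtain c where c: "(m, c) \<in> T" "(c, v) \<in> T\<^sup>*"
    by (cases rule: converse_rtranclE) (use below[OF v] in auto)
  define B where "B = {x. (c, x) \<in> T\<^sup>*}"
  have cB: "c \<in> B" and vB: "v \<in> B"
    using c by (auto simp: B_def)
  have le_c: "x \<le> c \<and> x \<in> W" if "(c, x) \<in> T\<^sup>*" for x
    using that by induction (use edge c in \<open>fastforce+\<close>)
  then have BW: "B \<subseteq> W"
    by (auto simp: B_def)
  then have finB: "finite B"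
    using fin finite_subset by blast
  have MaxB: "Max B = c"
    using cB le_c finB by (intro Max_eqI) (auto simp: B_def)
  have closed: "y \<in> B" if "x \<in> B" "(x, y) \<in> T" for x y
    using that by (auto simp: B_def)
  have parentB: "u \<in> B" if ux: "(u, x) \<in> T" and "x \<in> B" "x \<noteq> c" for u x
  proof -
    have "(c, x) \<in> T\<^sup>*"
      using that by (simp add: B_def)
    then obtain u' where "(c, u') \<in> T\<^sup>*" "(u', x) \<in> T"
      using \<open>x \<noteq> c\<close> by (metis rtranclE)
    then show ?thesis
      using uniq[OF ux] by (auto simp: B_def)
  qed
  have not_m: "m \<notin> W"
    using below by blast
  define C where "C = W - B"
  have finC: "finite C"
    using fin by (simp add: C_def)
  have parentC: "u = m \<or> u \<in> C" if "(u, x) \<in> T" "x \<in> C" for u x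
    using that edge closed by (auto simp: C_def)
  \<comment> \<open>A parent of \<open>Max C\<close> has a larger label, so it cannot lie in \<open>C\<close>.\<close>
  have MaxC: "(m, Max C) \<in> T" if "C \<noteq> {}"
  proof -
    have "Max C \<in> C"
      using that finC by simp
    then obtain u where u: "(u, Max C) \<in> T"
      using parent by (auto simp: C_def)
    moreover have "u \<notin> C"
      using edge(3)[OF u] finC Max_ge leD by blast
    ultimately show ?thesis
      using parentC \<open>Max C \<in> C\<close> by blast
  qed
  \<comment> \<open>Otherwise \<open>c\<close>, \<open>x\<close> and \<open>Max C\<close> would be three children of the root.\<close>
  have rootC: "x = Max C" if "(m, x) \<in> T" "x \<in> C" for x
  proof (rule ccontr)
    assume ne: "x \<noteq> Max C"
    have MC: "Max C \<in> C"
      using that Max_in[OF finC] by blast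
    have "{c, x, Max C} \<subseteq> children T m"
      using c that MaxC by (auto simp: children_def)
    moreover have "finite (children T m)"
      by (rule finite_subset[of _ W]) (use edge fin in \<open>auto simp: children_def\<close>)
    moreover have "c \<noteq> x" "c \<noteq> Max C"
      using cB that(2) MC unfolding C_def by blast+
    then have "card {c, x, Max C} = 3"
      using ne by simp
    ultimately have "3 \<le> card (children T m)"
      by (metis card_mono)
    then show False
      using dec_treesD(5)[OF T, of m] by simp
  qed
  have sub_children: "card (children (T \<inter> X) x) \<le> 2" if "x \<in> W" for x X
  proof -
    have "finite (children T x)"
      by (rule finite_subset[of _ W]) (use edge fin in \<open>auto simp: children_def\<close>)
    then have "card (children (T \<inter> X) x) \<le> card (children T x)"
      by (intro card_mono) (auto simp: children_def)
    then show ?thesis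
      using dec_treesD(5)[OF T, of x] that by simp
  qed
  have dB: "T \<inter> B \<times> B \<in> dec_trees B"
  proof -
    have "\<exists>!u. (u, x) \<in> T \<inter> B \<times> B" if "x \<in> B" "x \<noteq> Max B" for x
      using that parent parentB uniq BW unfolding MaxB by blast
    then show ?thesis
      using edge(3) sub_children BW unfolding dec_trees_def by blast
  qed
  have dC: "T \<inter> C \<times> C \<in> dec_trees C"
  proof -
    have "\<exists>!u. (u, x) \<in> T \<inter> C \<times> C" if x: "x \<in> C" "x \<noteq> Max C" for x
    proof -
      obtain u where "(u, x) \<in> T"
        using parent x by (auto simp: C_def)
      moreover from this have "u \<in> C"
        using parentC rootC x by blast
      ultimately show ?thesis
        using x uniq by blast
    qed
    moreover have "C \<subseteq> W"
      by (auto simp: C_def)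
    ultimately show ?thesis
      using edge(3) sub_children unfolding dec_trees_def by blast
  qed
  have "T = join m B C (T \<inter> B \<times> B) (T \<inter> C \<times> C)"
  proof (intro equalityI subrelI)
    fix u x assume ux: "(u, x) \<in> T"
    have x: "x \<in> B \<or> x \<in> C"
      using edge[OF ux] by (auto simp: C_def)
    show "(u, x) \<in> join m B C (T \<inter> B \<times> B) (T \<inter> C \<times> C)"
    proof (cases "u = m")
      case True
      have "x = c" if "x \<in> B"
        using parentB[OF ux that] True BW not_m by blast
      then show ?thesis
        using x True ux rootC finB finC MaxB cB by (auto simp: join_def root_set_iff)
    next
      case False
      then have "u \<in> W"
        using edge[OF ux] by simp
      moreover have "u \<in> B" if "x \<in> B"
      proof (cases "x = c")
        case True
        then show ?thesis
          using uniq[OF ux] c False by blast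
      qed (use parentB ux that in blast)
      ultimately show ?thesis
        using x ux parentC False by (auto simp: join_def)
    qed
  next
    fix u x assume "(u, x) \<in> join m B C (T \<inter> B \<times> B) (T \<inter> C \<times> C)"
    then show "(u, x) \<in> T"
      using c MaxC MaxB finB finC by (auto simp: join_def root_set_iff)
  qed
  then show ?thesis
    using that[of B] BW vB dB dC unfolding C_def by blast
qed

text \<open>
  Since \<open>v\<close> tells the two pieces apart, every unordered pair of subtrees is counted once and no
  factor \<open>1 / 2\<close> appears.
\<close>
lemma card_marked_below_root:
  assumes fin: "finite W" and below: "\<And>x. x \<in> W \<Longrightarrow> x < m"
  shows "card {(T, v) \<in> marked_trees Q (insert m W). v \<noteq> m} =
    (\<Sum>B\<in>Pow W. card (marked_trees Q B) * card (dec_trees (W - B)))"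
proof -
  let ?D = "SIGMA B:Pow W. marked_trees Q B \<times> dec_trees (W - B)"
  let ?f = "\<lambda>(B, (T, v), S). (join m B (W - B) T S, v)"
  have ctx: "finite B" "finite (W - B)" "B \<inter> (W - B) = {}" "insert m (B \<union> (W - B)) = insert m W"
    "\<And>x. x \<in> B \<union> (W - B) \<Longrightarrow> x < m" if "B \<subseteq> W" for B
    using that fin below finite_subset by auto
  have "bij_betw ?f ?D {(T, v) \<in> marked_trees Q (insert m W). v \<noteq> m}"
    unfolding bij_betw_def
  proof
    show "inj_on ?f ?D"
    proof (rule inj_onI)
      fix p p' assume D: "p \<in> ?D" "p' \<in> ?D" and p_eq: "?f p = ?f p'"
      obtain B T v S where p: "p = (B, (T, v), S)"
        by (cases p) auto
      obtain B' T' S' where p': "p' = (B', (T', v), S')"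
        using p_eq unfolding p by (cases p') auto
      have B: "B \<subseteq> W" "B' \<subseteq> W" and T: "(T, v) \<in> marked_trees Q B" "(T', v) \<in> marked_trees Q B'"
        and S: "S \<in> dec_trees (W - B)" "S' \<in> dec_trees (W - B')"
        and eq: "join m B (W - B) T S = join m B' (W - B') T' S'"
        using D p_eq unfolding p p' by auto
      have T': "T \<in> dec_trees B" "T' \<in> dec_trees B'" "v \<in> B" "v \<in> B'"
        using T by (auto simp: marked_trees_def)
      note c1 = ctx(1-3,5)[OF B(1)] T'(1) S(1)
      note c2 = ctx(1-3,5)[OF B(2)] T'(2) S(2)
      have "B = B'"
        using join_component[OF c1 T'(3)] join_component[OF c2 T'(4)] unfolding eq by (rule trans[OF _ sym])
      then show "p = p'"
        using join_restrict[OF c1] join_restrict[OF c2] eq unfolding p p' by simp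
    qed
  next
    show "?f ` ?D = {(T, v) \<in> marked_trees Q (insert m W). v \<noteq> m}"
    proof (intro equalityI subsetI)
      fix p assume "p \<in> ?f ` ?D"
      then obtain B T v S where p: "p = (join m B (W - B) T S, v)" and B: "B \<subseteq> W"
        and T: "(T, v) \<in> marked_trees Q B" and S: "S \<in> dec_trees (W - B)"
        by auto
      have T': "T \<in> dec_trees B" "v \<in> B" "Q (leaf_path_lengths T v)"
        using T by (auto simp: marked_trees_def)
      note c = ctx(1-3,5)[OF B] T'(1) S
      show "p \<in> {(T, v) \<in> marked_trees Q (insert m W). v \<noteq> m}"
        using join_dec_trees[OF c] join_leaf_path_lengths[OF c T'(2)] T' B below
        unfolding p ctx(4)[OF B] by (auto simp: marked_trees_def)
    next
      fix p assume "p \<in> {(T, v) \<in> marked_trees Q (insert m W). v \<noteq> m}"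
      then obtain T v where p: "p = (T, v)" and T: "T \<in> dec_trees (insert m W)" and v: "v \<in> W"
        and Q: "Q (leaf_path_lengths T v)"
        by (auto simp: marked_trees_def)
      obtain B where B: "B \<subseteq> W" "v \<in> B" and d: "T \<inter> B \<times> B \<in> dec_trees B"
        "T \<inter> (W - B) \<times> (W - B) \<in> dec_trees (W - B)"
        and T_eq: "T = join m B (W - B) (T \<inter> B \<times> B) (T \<inter> (W - B) \<times> (W - B))"
        using dec_trees_split[OF T fin below v] by metis
      have "leaf_path_lengths T v = leaf_path_lengths (T \<inter> B \<times> B) v"
        using join_leaf_path_lengths[OF ctx(1-3,5)[OF B(1)] d B(2)] T_eq by simp
      then have "(B, (T \<inter> B \<times> B, v), T \<inter> (W - B) \<times> (W - B)) \<in> ?D"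
        using B d Q by (auto simp: marked_trees_def)
      moreover have "p = ?f (B, (T \<inter> B \<times> B, v), T \<inter> (W - B) \<times> (W - B))"
        unfolding p using T_eq by simp
      ultimately show "p \<in> ?f ` ?D"
        by (rule rev_image_eqI)
    qed
  qed
  then have "card {(T, v) \<in> marked_trees Q (insert m W). v \<noteq> m} = card ?D"
    by (rule bij_betw_same_card[symmetric])
  also have "\<dots> = (\<Sum>B\<in>Pow W. card (marked_trees Q B \<times> dec_trees (W - B)))"
    using fin ctx by (intro card_SigmaI) (auto simp: finite_marked_trees finite_dec_trees)
  finally show ?thesis
    by (simp add: card_cartesian_product)
qed


section \<open>Generating functions\<close>

definition num_trees :: "nat \<Rightarrow> nat" where
  "num_trees n = card (dec_trees {1..n})"

definition num_marked :: "(nat set \<Rightarrow> bool) \<Rightarrow> nat \<Rightarrow> nat" where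
  "num_marked Q n = card (marked_trees Q {1..n})"

text \<open>The condition \<open>n > 0\<close> excludes the empty tree, which has no root.\<close>
definition num_root_marked :: "(nat set \<Rightarrow> bool) \<Rightarrow> nat \<Rightarrow> nat" where
  "num_root_marked Q n = card {T \<in> dec_trees {1..n}. n > 0 \<and> Q (leaf_path_lengths T n)}"

lemma sum_Pow_by_card:
  fixes f :: "nat \<Rightarrow> nat"
  assumes "finite W"
  shows "(\<Sum>B\<in>Pow W. f (card B)) = (\<Sum>i\<le>card W. (card W choose i) * f i)"
proof -
  have "(\<Sum>B\<in>Pow W. f (card B)) = (\<Sum>i\<le>card W. \<Sum>B\<in>{B \<in> Pow W. card B = i}. f (card B))"
    using assms by (intro sum.group[symmetric]) (auto intro: card_mono)
  also have "\<dots> = (\<Sum>i\<le>card W. card {B. B \<subseteq> W \<and> card B = i} * f i)"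
    by (intro sum.cong) auto
  finally show ?thesis
    using assms by (simp add: n_subsets)
qed

text \<open>
  The distinguished vertex is either the root or lies below it.  The label sets of the two pieces
  matter only through their sizes, which turns the sum over subsets into a binomial convolution.
\<close>
lemma num_marked_Suc:
  "num_marked Q (Suc n) =
    num_root_marked Q (Suc n) + (\<Sum>i\<le>n. (n choose i) * (num_marked Q i * num_trees (n - i)))"
proof -
  let ?W = "{1..n}" and ?m = "Suc n"
  have V: "{1..?m} = insert ?m ?W"
    by auto
  let ?M = "marked_trees Q {1..?m}"
  let ?R = "{T \<in> dec_trees {1..?m}. Q (leaf_path_lengths T ?m)}"
  let ?N = "{(T, v) \<in> ?M. v \<noteq> ?m}"
  have finN: "finite ?N"
    by (rule finite_subset[OF _ finite_marked_trees[of "{1..?m}" Q]]) auto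
  have M: "?M = ?N \<union> (\<lambda>T. (T, ?m)) ` ?R"
    by (auto simp: marked_trees_def)
  have card_M: "card ?M = card ?N + card ((\<lambda>T. (T, ?m)) ` ?R)"
    by (subst M, rule card_Un_disjoint[OF finN]) (auto simp: finite_dec_trees)
  have card_R: "card ((\<lambda>T. (T, ?m)) ` ?R) = card ?R"
    by (rule card_image) (rule inj_onI, simp)
  have "card ?N = (\<Sum>B\<in>Pow ?W. card (marked_trees Q B) * card (dec_trees (?W - B)))"
    unfolding V by (rule card_marked_below_root) auto
  also have "\<dots> = (\<Sum>B\<in>Pow ?W. num_marked Q (card B) * num_trees (n - card B))"
  proof (intro sum.cong refl)
    fix B assume "B \<in> Pow ?W"
    then have sub: "B \<subseteq> ?W"
      by simp
    then have "finite B"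
      by (rule finite_subset) simp
    with sub have B: "finite B" "card (?W - B) = n - card B"
      by (simp_all add: card_Diff_subset)
    have "card (marked_trees Q B) = num_marked Q (card B)"
      unfolding num_marked_def using B by (intro card_marked_trees_cong) auto
    moreover have "card (dec_trees (?W - B)) = num_trees (n - card B)"
      unfolding num_trees_def using B by (intro card_dec_trees_cong) auto
    ultimately show "card (marked_trees Q B) * card (dec_trees (?W - B)) =
        num_marked Q (card B) * num_trees (n - card B)"
      by simp
  qed
  also have "\<dots> = (\<Sum>i\<le>n. (n choose i) * (num_marked Q i * num_trees (n - i)))"
    using sum_Pow_by_card[of ?W "\<lambda>i. num_marked Q i * num_trees (n - i)"] by simp
  finally show ?thesis
    using card_M card_R by (simp add: num_marked_def num_root_marked_def)
qed

lemma egf_nth: "fps_nth (egf s) n = of_nat (s n) / fact n"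
  by (simp add: egf_def)

lemma egf_deriv_nth: "fps_nth (fps_deriv (egf s)) n = of_nat (s (Suc n)) / fact n"
  by (simp add: egf_nth del: of_nat_Suc)

lemma egf_mult_nth:
  "fps_nth (egf s * egf t) n = of_nat (\<Sum>i\<le>n. (n choose i) * (s i * t (n - i))) / fact n"
  unfolding fps_mult_nth egf_nth of_nat_sum sum_divide_distrib atMost_atLeast0
  by (intro sum.cong) (auto simp: binomial_fact field_simps)

lemma marked_egf_equation:
  "fps_deriv (egf (num_marked Q)) - egf (num_marked Q) * egf num_trees =
    fps_deriv (egf (num_root_marked Q))"
  by (rule fps_ext)
    (simp only: fps_sub_nth egf_deriv_nth egf_mult_nth num_marked_Suc of_nat_add
      add_divide_distrib add_diff_cancel_right')

lemma num_trees_0: "num_trees 0 = 1"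
  by (simp add: num_trees_def)

lemma num_marked_True: "num_marked (\<lambda>_. True) n = n * num_trees n"
proof -
  have "marked_trees (\<lambda>_. True) {1..n} = dec_trees {1..n} \<times> {1..n}"
    by (auto simp: marked_trees_def)
  then show ?thesis
    by (simp add: num_marked_def num_trees_def card_cartesian_product)
qed

lemma num_root_marked_True: "num_root_marked (\<lambda>_. True) (Suc n) = num_trees (Suc n)"
  by (simp add: num_root_marked_def num_trees_def)

text \<open>
  Distinguishing an arbitrary vertex multiplies the number of trees by \<open>n\<close>, which is \<open>x d/dx\<close> on
  generating functions; the factor \<open>x\<close> cancels.
\<close>
lemma tree_egf_equation:
  "fps_deriv (fps_deriv (egf num_trees)) = fps_deriv (egf num_trees) * egf num_trees"
proof -
  let ?Y = "egf num_trees"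
  have 1: "egf (num_marked (\<lambda>_. True)) = fps_X * fps_deriv ?Y"
  proof (rule fps_ext)
    fix n show "fps_nth (egf (num_marked (\<lambda>_. True))) n = fps_nth (fps_X * fps_deriv ?Y) n"
      by (cases n) (simp_all add: egf_nth num_marked_True field_simps)
  qed
  have 2: "fps_deriv (egf (num_root_marked (\<lambda>_. True))) = fps_deriv ?Y"
    by (rule fps_ext) (simp only: egf_deriv_nth num_root_marked_True)
  have "fps_X * fps_deriv (fps_deriv ?Y) = fps_X * (fps_deriv ?Y * ?Y)"
    using marked_egf_equation[of "\<lambda>_. True"] unfolding 1 2 by (simp add: algebra_simps)
  then show ?thesis
    by simp
qed

text \<open>
  All divisions are avoided by multiplying with \<open>cos\<^sup>2 x\<close>: since \<open>y cos x = 1 + sin x\<close>, both sides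
  become \<open>2 (1 + sin x)\<close>.
\<close>
lemma y_fps_equation: "2 * fps_deriv y_fps = 1 + y_fps\<^sup>2"
proof -
  let ?c = "fps_cos 1 :: real fps" and ?s = "fps_sin 1 :: real fps"
  have inv: "?c * inverse ?c = 1"
    by (rule inverse_mult_eq_1') simp
  then have c0: "?c \<noteq> 0"
    by auto
  have cy: "?c * y_fps = 1 + ?s"
    using inv by (simp add: y_fps_def fps_tan_def fps_divide_unit algebra_simps)
  have cs: "?c\<^sup>2 + ?s\<^sup>2 = 1"
    by (rule fps_sin_cos_sum_of_squares)
  have "fps_deriv (?c * y_fps) = fps_deriv (1 + ?s)"
    by (simp only: cy)
  then have dy: "?c * fps_deriv y_fps - ?s * y_fps = ?c"
    by (simp add: fps_sin_deriv fps_cos_deriv flip: fps_const_neg)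
  have "?c\<^sup>2 * (2 * fps_deriv y_fps) = ?c\<^sup>2 * (1 + y_fps\<^sup>2)"
    using cy dy cs by algebra
  then show ?thesis
    using c0 by simp
qed

text \<open>The equation expresses the coefficient of \<open>x\<^sup>k\<^sup>+\<^sup>2\<close> through those up to \<open>x\<^sup>k\<^sup>+\<^sup>1\<close>.\<close>
lemma second_order_ode_unique:
  fixes f g :: "real fps"
  assumes f: "fps_deriv (fps_deriv f) = fps_deriv f * f"
    and g: "fps_deriv (fps_deriv g) = fps_deriv g * g"
    and init: "fps_nth f 0 = fps_nth g 0" "fps_nth f 1 = fps_nth g 1"
  shows "f = g"
proof (rule fps_ext)
  fix n show "fps_nth f n = fps_nth g n"
  proof (induction n rule: less_induct)
    case (less n)
    consider "n = 0" | "n = 1" | k where "n = Suc (Suc k)"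
      by (metis One_nat_def not0_implies_Suc)
    then show ?case
    proof cases
      case 3
      have "fps_nth (fps_deriv f * f) k = fps_nth (fps_deriv g * g) k"
        unfolding fps_mult_nth using less 3 by (intro sum.cong) auto
      then have "fps_nth (fps_deriv (fps_deriv f)) k = fps_nth (fps_deriv (fps_deriv g)) k"
        by (simp only: f g)
      then show ?thesis
        by (simp add: 3)
    qed (use init in auto)
  qed
qed

lemma num_trees_1: "num_trees 1 = 1"
proof -
  have "dec_trees {1} = {{}}"
    by (auto simp: dec_trees_def children_def)
  then show ?thesis
    by (simp add: num_trees_def)
qed

lemma tree_egf_eq_y: "egf num_trees = y_fps"
proof (rule second_order_ode_unique)
  have "fps_deriv (2 * fps_deriv y_fps) = fps_deriv (1 + y_fps\<^sup>2)"
    by (simp only: y_fps_equation)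
  then have "2 * fps_deriv (fps_deriv y_fps) = 2 * (fps_deriv y_fps * y_fps)"
    by (simp add: power2_eq_square algebra_simps)
  then show "fps_deriv (fps_deriv y_fps) = fps_deriv y_fps * y_fps"
    by simp
  have y0: "fps_nth y_fps 0 = 1"
    by (simp add: y_fps_def fps_tan_def fps_divide_unit)
  then show "fps_nth (egf num_trees) 0 = fps_nth y_fps 0"
    by (simp add: egf_nth num_trees_0)
  have "fps_nth (2 * fps_deriv y_fps) 0 = fps_nth (1 + y_fps\<^sup>2) 0"
    by (simp only: y_fps_equation)
  then show "fps_nth (egf num_trees) 1 = fps_nth y_fps 1"
    using y0 num_trees_1 by (simp add: egf_nth power2_eq_square)
qed (rule tree_egf_equation)


section \<open>Balanced vertices\<close>

definition balanced_lengths_of_rank :: "nat \<Rightarrow> nat set \<Rightarrow> bool" where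
  "balanced_lengths_of_rank k L \<longleftrightarrow> (\<forall>l\<in>L. \<forall>m\<in>L. l = m) \<and> (THE l. l \<in> L) = k"

lemma balanced_iff:
  "balanced T v \<and> balanced_rank T v = k \<longleftrightarrow> balanced_lengths_of_rank k (leaf_path_lengths T v)"
  by (simp add: balanced_def balanced_rank_def balanced_lengths_of_rank_def)

lemma num_balanced_eq: "num_balanced k = num_marked (balanced_lengths_of_rank k)"
proof
  fix n
  show "num_balanced k n = num_marked (balanced_lengths_of_rank k) n"
  proof (cases "n = 0")
    case True
    then show ?thesis
      by (simp add: num_balanced_def trees12_0 num_marked_def marked_trees_def)
  next
    case False
    then show ?thesis
      by (simp add: num_balanced_def balanced_iff trees12_eq sum.reindex inj_on_def
          num_marked_def marked_trees_def card_SigmaI finite_dec_trees)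
  qed
qed

lemma num_root_balanced_eq: "num_root_balanced k = num_root_marked (balanced_lengths_of_rank k)"
proof
  fix n
  show "num_root_balanced k n = num_root_marked (balanced_lengths_of_rank k) n"
  proof (cases "n = 0")
    case True
    then show ?thesis
      by (simp add: num_root_balanced_def trees12_0 num_root_marked_def)
  next
    case False
    then have "{(r, T). (r, T) \<in> trees12 n \<and> balanced T r \<and> balanced_rank T r = k} =
        Pair n ` {T \<in> dec_trees {1..n}. n > 0 \<and> balanced_lengths_of_rank k (leaf_path_lengths T n)}"
      by (auto simp: trees12_eq balanced_iff)
    then show ?thesis
      by (simp add: num_root_balanced_def num_root_marked_def card_image inj_on_def)
  qed
qed

theorem theorem2p1:
  fixes k :: nat
  shows "fps_deriv (A_egf k) - A_egf k * y_fps = fps_deriv (R_egf k) \<and> fps_nth (A_egf k) 0 = 0"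
proof
  show "fps_deriv (A_egf k) - A_egf k * y_fps = fps_deriv (R_egf k)"
    using marked_egf_equation[of "balanced_lengths_of_rank k"]
    by (simp only: A_egf_def R_egf_def num_balanced_eq num_root_balanced_eq tree_egf_eq_y)
  show "fps_nth (A_egf k) 0 = 0"
    by (simp add: A_egf_def egf_nth num_balanced_def trees12_0)
qed

end
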